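(* Let $(\mathcal{P}_1,\mathcal{L}_1)$ and $(\mathcal{P}_2,\mathcal{L}_2)$ be two $(n_s,m_k)$-configurations with disjoint point sets, and consider a connected sum of them. Its point set is partitioned into the points $\mathcal{P}_1$ of the first configuration and the points $\mathcal{P}_2$ of the second. Then no triangle of the connected sum has points from both $\mathcal{P}_1$ and $\mathcal{P}_2$.
   Context: An $(n_s,m_k)$-configuration is a pair $(\mathcal{P},\mathcal{L})$ with $\mathcal{P}$ a set of $n\geq 3$ points and $\mathcal{L}$ a set of $m$ subsets of $\mathcal{P}$ called lines, such that any two distinct points lie together on at most one line, every point is on exactly $s$ lines, and every line contains exactly $k$ points. Three points $p_1,p_2,p_3$ form a triangle if there are lines $l_1,l_2,l_3$ with $p_1,p_2\in l_1$, $p_3\notin l_1$; $p_2,p_3\in l_2$, $p_1\notin l_2$; $p_1,p_3\in l_3$, $p_2\notin l_3$. A connected sum of two $(n_s,m_k)$-configurations $(\mathcal{P}_1,\mathcal{L}_1)$, $(\mathcal{P}_2,\mathcal{L}_2)$ (with disjoint point sets) is the $(2n_s,2m_k)$-configuration (that is, with $2n$ points and $2m$ lines, $s$ lines per point and $k$ points per line) obtained as follows: choose a point $p_1\in\mathcal{P}_1$ on a line $l_1\in\mathcal{L}_1$ and a point $p_2\in\mathcal{P}_2$ on a line $l_2\in\mathcal{L}_2$; take the point set $\mathcal{P}_1\cup\mathcal{P}_2$ and the lines $\mathcal{L}_1\cup\mathcal{L}_2$, except that $l_1$ is replaced by $(l_1\setminus\{p_1\})\cup\{p_2\}$ and $l_2$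 by $(l_2\setminus\{p_2\})\cup\{p_1\}$. The result may depend on the choices. *)

theory Defs
  imports Main "HOL-Library.Disjoint_Sets"
begin

(* The condition 3 \<le> card P makes P, hence also L, finite, so the cardinalities below
   are genuine. *)
definition configuration :: "nat \<Rightarrow> nat \<Rightarrow> nat \<Rightarrow> nat \<Rightarrow> 'a set \<Rightarrow> 'a set set \<Rightarrow> bool" where
  "configuration n s m k P L \<longleftrightarrow>
     n \<ge> 3 \<and> card P = n \<and> card L = m \<and> (\<forall>l\<in>L. l \<subseteq> P) \<and>
     (\<forall>p\<in>P. \<forall>q\<in>P. p \<noteq> q \<longrightarrow>
        (\<forall>l\<in>L. \<forall>l'\<in>L. p \<in> l \<and> q \<in> l \<and> p \<in> l' \<and> q \<in> l' \<longrightarrow> l = l')) \<and>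
     (\<forall>p\<in>P. card {l \<in> L. p \<in> l} = s) \<and>
     (\<forall>l\<in>L. card l = k)"

definition triangle :: "'a set \<Rightarrow> 'a set set \<Rightarrow> 'a \<Rightarrow> 'a \<Rightarrow> 'a \<Rightarrow> bool" where
  "triangle P L p1 p2 p3 \<longleftrightarrow>
     p1 \<in> P \<and> p2 \<in> P \<and> p3 \<in> P \<and>
     (\<exists>l1\<in>L. \<exists>l2\<in>L. \<exists>l3\<in>L.
        p1 \<in> l1 \<and> p2 \<in> l1 \<and> p3 \<notin> l1 \<and>
        p2 \<in> l2 \<and> p3 \<in> l2 \<and> p1 \<notin> l2 \<and>
        p1 \<in> l3 \<and> p3 \<in> l3 \<and> p2 \<notin> l3)"

(* A relation rather than a function, because the result (P, L) depends on the chosen points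
   and lines. It is meant for configurations with P1 and P2 disjoint. *)
definition connected_sum ::
  "'a set \<Rightarrow> 'a set set \<Rightarrow> 'a set \<Rightarrow> 'a set set \<Rightarrow> 'a set \<Rightarrow> 'a set set \<Rightarrow> bool" where
  "connected_sum P1 L1 P2 L2 P L \<longleftrightarrow>
     (\<exists>p1\<in>P1. \<exists>l1\<in>L1. \<exists>p2\<in>P2. \<exists>l2\<in>L2.
        p1 \<in> l1 \<and> p2 \<in> l2 \<and>
        P = P1 \<union> P2 \<and>
        L = (L1 - {l1}) \<union> (L2 - {l2}) \<union> {(l1 - {p1}) \<union> {p2}, (l2 - {p2}) \<union> {p1}})"

end

theory Submission
  imports Defs
begin

text \<open>
  The only lines of the connected sum that meet both point sets are the two modified ones. Since
  \<open>p2\<close> is the only point of \<open>P2\<close> on the first and does not lie on the second, and symmetrically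
  for \<open>p1\<close>, these two lines are disjoint. A mixed triangle has one vertex on one side
  and two on the other, and the two sides through the isolated vertex would be distinct mixed
  lines that meet.
\<close>

lemma configuration_lines_subset: "configuration n s m k P L \<Longrightarrow> l \<in> L \<Longrightarrow> l \<subseteq> P"
  by (auto simp: configuration_def)

lemma configuration_nonempty: "configuration n s m k P L \<Longrightarrow> P \<noteq> {}"
  by (auto simp: configuration_def)

text \<open>Exchanging the two choices only reorders unions and the two new lines. This reduces
  triangles with two vertices in \<open>P2\<close> to those with two in \<open>P1\<close>.\<close>

lemma connected_sum_commute:
  assumes "connected_sum P1 L1 P2 L2 P L"
  shows "connected_sum P2 L2 P1 L1 P L"
proof -
  from assms obtain p1 l1 p2 l2
    where "p1 \<in> P1" "l1 \<in> L1" "p2 \<in> P2" "l2 \<in> L2" "p1 \<in> l1" "p2 \<in> l2" "P = P1 \<union> P2"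
      and "L = (L1 - {l1}) \<union> (L2 - {l2}) \<union> {(l1 - {p1}) \<union> {p2}, (l2 - {p2}) \<union> {p1}}"
    unfolding connected_sum_def by blast
  moreover from this have "P = P2 \<union> P1"
    and "L = (L2 - {l2}) \<union> (L1 - {l1}) \<union> {(l2 - {p2}) \<union> {p1}, (l1 - {p1}) \<union> {p2}}"
    by auto
  ultimately show ?thesis
    unfolding connected_sum_def by blast
qed

lemma connected_sum_mixed_lines_eq:
  assumes sum: "connected_sum P1 L1 P2 L2 P L"
    and sub1: "\<And>l. l \<in> L1 \<Longrightarrow> l \<subseteq> P1" and sub2: "\<And>l. l \<in> L2 \<Longrightarrow> l \<subseteq> P2"
    and disj: "P1 \<inter> P2 = {}"
    and l: "l \<in> L" "a \<in> l" "c \<in> l" and l': "l' \<in> L" "b \<in> l'" "c \<in> l'"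
    and "a \<in> P1" "b \<in> P1" "c \<in> P2"
  shows "l = l'"
proof -
  from sum obtain p1 l1 p2 l2
    where p: "p1 \<in> P1" "l1 \<in> L1" "p2 \<in> P2" "l2 \<in> L2"
      and L: "L = (L1 - {l1}) \<union> (L2 - {l2}) \<union> {(l1 - {p1}) \<union> {p2}, (l2 - {p2}) \<union> {p1}}"
    unfolding connected_sum_def by blast
  \<comment> \<open>An unmodified line lies inside \<open>P1\<close> or inside \<open>P2\<close>, so
    it cannot contain both \<open>x\<close> and \<open>c\<close>.\<close>
  have mixed: "h \<in> {(l1 - {p1}) \<union> {p2}, (l2 - {p2}) \<union> {p1}}"
    if "h \<in> L" "x \<in> h" "x \<in> P1" "c \<in> h" for h x
    using that \<open>c \<in> P2\<close> L disj sub1 sub2 by blast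
  \<comment> \<open>On the first new line \<open>c\<close> could only be \<open>p2\<close>, which
    was removed from \<open>l2\<close>; and \<open>c\<close> differs from \<open>p1\<close>, a point
    of \<open>P1\<close>.\<close>
  have "c \<notin> ((l1 - {p1}) \<union> {p2}) \<inter> ((l2 - {p2}) \<union> {p1})"
    using p disj \<open>c \<in> P2\<close> sub1[OF p(2)] by blast
  then show ?thesis
    using mixed[OF l(1,2) \<open>a \<in> P1\<close> l(3)] mixed[OF l'(1,2) \<open>b \<in> P1\<close> l'(3)] l(3) l'(3) by blast
qed

lemma triangle_rotate: "triangle P L a b c \<Longrightarrow> triangle P L b c a"
  unfolding triangle_def by blast

text \<open>The sides through the isolated vertex \<open>c\<close> both join it to
  \<open>P1\<close>, so they coincide; but then the side through \<open>b\<close> and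
  \<open>c\<close> also contains \<open>a\<close>, which a triangle forbids.\<close>

lemma connected_sum_not_triangle:
  assumes "connected_sum P1 L1 P2 L2 P L"
    and "\<And>l. l \<in> L1 \<Longrightarrow> l \<subseteq> P1" "\<And>l. l \<in> L2 \<Longrightarrow> l \<subseteq> P2" "P1 \<inter> P2 = {}"
    and "a \<in> P1" "b \<in> P1" "c \<in> P2"
  shows "\<not> triangle P L a b c"
proof
  assume "triangle P L a b c"
  then obtain l l' where "l \<in> L" "a \<in> l" "c \<in> l" "l' \<in> L" "b \<in> l'" "c \<in> l'" "a \<notin> l'"
    unfolding triangle_def by blast
  with connected_sum_mixed_lines_eq[OF assms(1-4) this(1-6) assms(5-7)]
  show False by blast
qed

theorem proposition5p1:
  fixes P1 P2 P :: "'a set" and L1 L2 L :: "'a set set" and n s m k :: nat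
  assumes "configuration n s m k P1 L1"
    and "configuration n s m k P2 L2"
    and "P1 \<inter> P2 = {}"
    and "connected_sum P1 L1 P2 L2 P L"
  shows "partition_on P {P1, P2} \<and>
    \<not> (\<exists>a b c. triangle P L a b c \<and> {a, b, c} \<inter> P1 \<noteq> {} \<and> {a, b, c} \<inter> P2 \<noteq> {})"
proof
  have P: "P = P1 \<union> P2"
    using assms(4) by (auto simp: connected_sum_def)
  \<comment> \<open>The parts of a partition must be nonempty; here this comes from n \<ge>
    3.\<close>
  show "partition_on P {P1, P2}"
    using P assms(3) configuration_nonempty[OF assms(1)] configuration_nonempty[OF assms(2)]
    by (auto simp: partition_on_def disjoint_def)
  note sub1 = configuration_lines_subset[OF assms(1)]
  note sub2 = configuration_lines_subset[OF assms(2)]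
  have no12: "\<not> triangle P L a b c" if "a \<in> P1" "b \<in> P1" "c \<in> P2" for a b c
    using connected_sum_not_triangle[OF assms(4) sub1 sub2 assms(3) that] .
  have no21: "\<not> triangle P L a b c" if "a \<in> P2" "b \<in> P2" "c \<in> P1" for a b c
    using connected_sum_not_triangle[OF connected_sum_commute[OF assms(4)] sub2 sub1 _ that] assms(3)
    by blast
  show "\<not> (\<exists>a b c. triangle P L a b c \<and> {a, b, c} \<inter> P1 \<noteq> {} \<and> {a, b, c} \<inter> P2 \<noteq> {})"
  proof clarify
    fix a b c
    assume t: "triangle P L a b c"
      and mixed: "{a, b, c} \<inter> P1 \<noteq> {}" "{a, b, c} \<inter> P2 \<noteq> {}"
    \<comment> \<open>Any of the three vertices may be the isolated one; the rotations bring each of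
      them to the third place, where \<open>no12\<close> and \<open>no21\<close> expect it.\<close>
    note t' = triangle_rotate[OF t] and t'' = triangle_rotate[OF triangle_rotate[OF t]]
    have "a \<in> P1 \<union> P2" "b \<in> P1 \<union> P2" "c \<in> P1 \<union> P2"
      using t P by (auto simp: triangle_def)
    then show False
      using mixed assms(3) no12 no21 t t' t'' by blast
  qed
qed

end
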